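(* Let $d\in\mathbb{N}$, let $\Xi\subset\mathbb{R}^d$ be finite and symmetric, and let $\alpha\in\mathbb{N}^d$. Let $A\subset\mathbb{R}^d$ be a finite set, let $u\in\mathbb{C}^A$, and let $\phi_{A,u}:=\sum_{a\in A}u_a\delta_a$. Then $\phi_{A,u}$ is a feasible shift rule for $\Xi,\alpha$, i.e., $\phi_{A,u}*f=\partial^\alpha f$ for all $f\in\mathscr{K}_\Xi$, if and only if $$\sum_{a\in A}u_a\,e^{-2\pi i\, a\bullet\xi}=(2\pi i\,\xi)^\alpha\qquad\text{for all }\xi\in\Xi .$$
   Context: $\mathbb{N}=\{1,2,3,\dots\}$. A set $\Xi\subset\mathbb{R}^d$ is symmetric if $\Xi=-\Xi$. For $u,v\in\mathbb{R}^d$, $u\bullet v:=\sum_j u_jv_j$. $\mathscr{K}_\Xi$ denotes the real vector space of real-valued functions $f\colon\mathbb{R}^d\to\mathbb{R}$ of the form $f(x)=\sum_{\xi\in\Xi}b_\xi e^{2\pi i\,\xi\bullet x}$ with $b\in\mathbb{C}^\Xi$, $b_{-\xi}=\overline{b_\xi}$ for all $\xi\in\Xi$. For $\alpha\in\mathbb{N}^d$, $\partial^\alpha=\prod_{j=1}^d\partial_j^{\alpha_j}$ and $(2\pi i\,\xi)^\alpha=\prod_{j=1}^d(2\pi i\,\xi_j)^{\alpha_j}$. $\delta_a$ is the Dirac (point) measure at $a$, so $(\phi_{A,u}*f)(x)=\sum_{a\in A}u_af(x-a)$. *)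

theory Defs
  imports "HOL-Probability.Probability"
begin

definition symmetric_set :: "(real ^ 'n) set \<Rightarrow> bool" where
  "symmetric_set \<Xi> \<longleftrightarrow> \<Xi> = uminus ` \<Xi>"

text \<open>Only the values of \<open>b\<close> on \<open>\<Xi>\<close> matter, so \<open>b\<close> is a total function
  standing for an element of the space of complex families indexed by \<open>\<Xi>\<close>.\<close>

definition trig_space :: "(real ^ 'n) set \<Rightarrow> (real ^ 'n \<Rightarrow> real) set" where
  "trig_space \<Xi> = {f. \<exists>b :: real ^ 'n \<Rightarrow> complex.
      (\<forall>\<xi>\<in>\<Xi>. b (- \<xi>) = cnj (b \<xi>)) \<and>
      (\<forall>x. complex_of_real (f x) =
        (\<Sum>\<xi>\<in>\<Xi>. b \<xi> * exp (2 * complex_of_real pi * \<i> * complex_of_real (\<xi> \<bullet> x))))}"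

definition partial_deriv :: "'n \<Rightarrow> (real ^ 'n \<Rightarrow> real) \<Rightarrow> real ^ 'n \<Rightarrow> real" where
  "partial_deriv j f x = deriv (\<lambda>t. f (x + t *\<^sub>R axis j 1)) 0"

text \<open>A finite index type carries no canonical order, so the operators are composed along
  some fixed enumeration of the coordinates. On smooth functions, in particular on
  \<open>trig_space \<Xi>\<close>, partial derivatives commute and the choice is immaterial.\<close>

definition coord_list :: "'n::finite list" where
  "coord_list = (SOME js. distinct js \<and> set js = UNIV)"

definition mixed_deriv :: "nat ^ 'n \<Rightarrow> (real ^ 'n \<Rightarrow> real) \<Rightarrow> real ^ 'n \<Rightarrow> real" where
  "mixed_deriv \<alpha> f = foldr (\<lambda>j. partial_deriv j ^^ (\<alpha> $ j)) coord_list f"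

definition symbol_power :: "nat ^ 'n \<Rightarrow> real ^ 'n \<Rightarrow> complex" where
  "symbol_power \<alpha> \<xi> =
    (\<Prod>j\<in>UNIV. (2 * complex_of_real pi * \<i> * complex_of_real (\<xi> $ j)) ^ (\<alpha> $ j))"

text \<open>The libraries have no complex measures. The measure \<open>\<Sum>a\<in>A. u a \<delta>\<^sub>a\<close>
  is given by its data \<open>A\<close> and \<open>u\<close>, and its convolution with \<open>f\<close> is the
  corresponding linear combination of the convolutions with the Dirac measures
  \<open>\<delta>\<^sub>a = return borel a\<close>; for measurable \<open>f\<close> the integral is \<open>f (x - a)\<close>.\<close>

definition point_conv ::
  "(real ^ 'n) set \<Rightarrow> (real ^ 'n \<Rightarrow> complex) \<Rightarrow> (real ^ 'n \<Rightarrow> real) \<Rightarrow> real ^ 'n \<Rightarrow> complex" where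
  "point_conv A u f x =
    (\<Sum>a\<in>A. u a * complex_of_real (\<integral>y. f (x - y) \<partial>(return borel a)))"

definition feasible_shift_rule ::
  "(real ^ 'n) set \<Rightarrow> nat ^ 'n \<Rightarrow> (real ^ 'n) set \<Rightarrow> (real ^ 'n \<Rightarrow> complex) \<Rightarrow> bool" where
  "feasible_shift_rule \<Xi> \<alpha> A u \<longleftrightarrow>
    (\<forall>f\<in>trig_space \<Xi>. \<forall>x. point_conv A u f x = complex_of_real (mixed_deriv \<alpha> f x))"

end

theory Submission
  imports Defs
begin

text \<open>On an exponential \<open>e\<^sub>\<xi>\<close> both sides act by multiplication: convolution by
  \<open>\<Sum>a\<in>A. u a e\<^sub>\<xi>(-a)\<close>, the derivative by \<open>(2 \<pi> \<i> \<xi>)\<^sup>\<alpha>\<close>. Hence equal multipliers give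
  feasibility. Conversely, if \<open>c \<xi>\<close> is the difference of the multipliers, the real function
  \<open>\<gamma> e\<^sub>\<xi> + cnj \<gamma> e\<^bsub>-\<xi>\<^esub>\<close> evaluated at the origin gives \<open>\<gamma> c \<xi> + cnj \<gamma> c (-\<xi>) = 0\<close>;
  taking \<open>\<gamma> = 1\<close> and \<open>\<gamma> = \<i>\<close> isolates \<open>c \<xi> = 0\<close>, so no independence of characters
  is needed and \<open>\<xi> = 0\<close> is not special.\<close>

definition character :: "real ^ 'n \<Rightarrow> real ^ 'n \<Rightarrow> complex" where
  "character \<xi> x = exp (2 * complex_of_real pi * \<i> * complex_of_real (\<xi> \<bullet> x))"

text \<open>Reality is carried by the type of \<open>f\<close>, and the conjugate symmetry of
  \<open>b\<close> stays a separate condition in \<open>trig_space_iff\<close>. Each operator then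
  only has to be traced through its effect on \<open>b\<close>.\<close>

definition has_fourier_coeffs ::
  "(real ^ 'n) set \<Rightarrow> (real ^ 'n \<Rightarrow> complex) \<Rightarrow> (real ^ 'n \<Rightarrow> real) \<Rightarrow> bool" where
  "has_fourier_coeffs \<Xi> b f \<longleftrightarrow>
    (\<forall>x. complex_of_real (f x) = (\<Sum>\<xi>\<in>\<Xi>. b \<xi> * character \<xi> x))"

lemma trig_space_iff:
  "f \<in> trig_space \<Xi> \<longleftrightarrow>
    (\<exists>b. (\<forall>\<xi>\<in>\<Xi>. b (- \<xi>) = cnj (b \<xi>)) \<and> has_fourier_coeffs \<Xi> b f)"
  by (simp add: trig_space_def has_fourier_coeffs_def character_def)

lemma character_zero [simp]: "character \<xi> 0 = 1"
  by (simp add: character_def)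

lemma character_add: "character \<xi> (x + y) = character \<xi> x * character \<xi> y"
  by (simp add: character_def inner_add_right algebra_simps flip: exp_add)

lemma character_minus_left: "character (- \<xi>) x = cnj (character \<xi> x)"
  by (simp add: character_def exp_cnj)

lemma character_minus_right:
  "character \<xi> (- a) = exp (- (2 * complex_of_real pi * \<i> * complex_of_real (a \<bullet> \<xi>)))"
  by (simp add: character_def inner_commute)

lemma continuous_on_character [continuous_intros]: "continuous_on S (character \<xi>)"
  unfolding character_def by (intro continuous_intros)

lemma character_has_vector_derivative:
  "((\<lambda>t. character \<xi> (x + t *\<^sub>R axis j 1)) has_vector_derivative
      (2 * complex_of_real pi * \<i> * complex_of_real (\<xi> $ j)) * character \<xi> x) (at 0)"
proof -
  define c where "c = 2 * complex_of_real pi * \<i> * complex_of_real (\<xi> $ j)"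
  \<comment> \<open>Differentiate in a complex variable, then restrict to the real line; the base
    point is written \<open>complex_of_real 0\<close> to fit that restriction rule.\<close>
  have "((\<lambda>z. character \<xi> x * exp (c * z)) has_field_derivative c * character \<xi> x)
      (at (complex_of_real 0))"
    by (auto intro!: derivative_eq_intros)
  then have "((\<lambda>t. character \<xi> x * exp (c * complex_of_real t)) has_vector_derivative
      c * character \<xi> x) (at 0)"
    by (rule has_vector_derivative_real_field)
  moreover have "character \<xi> (x + t *\<^sub>R axis j 1) = character \<xi> x * exp (c * complex_of_real t)" for t
    unfolding character_add by (simp add: character_def c_def inner_axis algebra_simps)
  ultimately show ?thesis
    by (simp add: c_def)
qed

text \<open>The real part of the hypothesis gives differentiability of \<open>g\<close> with
  derivative \<open>Re D\<close>. The imaginary part differentiates the zero function, so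
  \<open>Im D = 0\<close> by uniqueness of derivatives.\<close>

lemma has_vector_derivative_of_real_imp:
  assumes "((\<lambda>t. complex_of_real (g t)) has_vector_derivative D) (at t)"
  shows "complex_of_real (deriv g t) = D"
proof -
  have "((\<lambda>t. Re (complex_of_real (g t))) has_vector_derivative Re D) (at t)"
    by (rule bounded_linear.has_vector_derivative[OF bounded_linear_Re assms])
  then have "deriv g t = Re D"
    by (intro DERIV_imp_deriv) (simp add: has_real_derivative_iff_has_vector_derivative)
  moreover have "((\<lambda>t. Im (complex_of_real (g t))) has_vector_derivative Im D) (at t)"
    by (rule bounded_linear.has_vector_derivative[OF bounded_linear_Im assms])
  then have "Im D = 0"
    using vector_derivative_at has_vector_derivative_const by fastforce
  ultimately show ?thesis
    by (simp add: complex_eq_iff)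
qed

lemma has_fourier_coeffs_partial_deriv:
  assumes "has_fourier_coeffs \<Xi> b f"
  shows "has_fourier_coeffs \<Xi>
    (\<lambda>\<xi>. (2 * complex_of_real pi * \<i> * complex_of_real (\<xi> $ j)) * b \<xi>) (partial_deriv j f)"
  unfolding has_fourier_coeffs_def
proof
  fix x
  let ?c = "\<lambda>\<xi>. 2 * complex_of_real pi * \<i> * complex_of_real (\<xi> $ j)"
  have "((\<lambda>t. \<Sum>\<xi>\<in>\<Xi>. b \<xi> * character \<xi> (x + t *\<^sub>R axis j 1)) has_vector_derivative
      (\<Sum>\<xi>\<in>\<Xi>. b \<xi> * (?c \<xi> * character \<xi> x))) (at 0)"
    by (intro has_vector_derivative_sum has_vector_derivative_mult_right
        character_has_vector_derivative)
  then have "((\<lambda>t. complex_of_real (f (x + t *\<^sub>R axis j 1))) has_vector_derivative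
      (\<Sum>\<xi>\<in>\<Xi>. b \<xi> * (?c \<xi> * character \<xi> x))) (at 0)"
    using assms by (simp add: has_fourier_coeffs_def)
  then show "complex_of_real (partial_deriv j f x) = (\<Sum>\<xi>\<in>\<Xi>. ?c \<xi> * b \<xi> * character \<xi> x)"
    unfolding partial_deriv_def
    by (simp add: has_vector_derivative_of_real_imp mult_ac)
qed

lemma has_fourier_coeffs_partial_deriv_funpow:
  assumes "has_fourier_coeffs \<Xi> b f"
  shows "has_fourier_coeffs \<Xi>
    (\<lambda>\<xi>. (2 * complex_of_real pi * \<i> * complex_of_real (\<xi> $ j)) ^ k * b \<xi>)
    ((partial_deriv j ^^ k) f)"
proof (induction k)
  case (Suc k)
  then show ?case
    using has_fourier_coeffs_partial_deriv[OF Suc.IH, of j] by (simp add: mult.assoc)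
qed (use assms in simp)

lemma coord_list_enum: "distinct (coord_list :: 'n::finite list)" "set (coord_list :: 'n list) = UNIV"
proof -
  have "\<exists>js :: 'n list. distinct js \<and> set js = UNIV"
    using finite_distinct_list[of "UNIV :: 'n set"] by auto
  then have "distinct (coord_list :: 'n list) \<and> set (coord_list :: 'n list) = UNIV"
    unfolding coord_list_def by (rule someI_ex)
  then show "distinct (coord_list :: 'n list)" "set (coord_list :: 'n list) = UNIV"
    by auto
qed

text \<open>Each partial derivative multiplies the coefficient at \<open>\<xi>\<close> by a scalar,
  so composing along a list multiplies by the product over that list. As \<open>coord_list\<close>
  contains every coordinate exactly once, this product is
  \<open>symbol_power \<alpha> \<xi>\<close>.\<close>

lemma has_fourier_coeffs_mixed_deriv:
  fixes \<Xi> :: "(real ^ 'n) set"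
  assumes "has_fourier_coeffs \<Xi> b f"
  shows "has_fourier_coeffs \<Xi> (\<lambda>\<xi>. symbol_power \<alpha> \<xi> * b \<xi>) (mixed_deriv \<alpha> f)"
proof -
  let ?c = "\<lambda>\<xi> j. (2 * complex_of_real pi * \<i> * complex_of_real (\<xi> $ j)) ^ (\<alpha> $ j)"
  have foldr_coeffs: "has_fourier_coeffs \<Xi> (\<lambda>\<xi>. (\<Prod>j\<leftarrow>js. ?c \<xi> j) * b \<xi>)
      (foldr (\<lambda>j. partial_deriv j ^^ (\<alpha> $ j)) js f)" for js
  proof (induction js)
    case (Cons j js)
    then show ?case
      using has_fourier_coeffs_partial_deriv_funpow[OF Cons.IH, of j "\<alpha> $ j"]
      by (simp add: mult.assoc)
  qed (use assms in simp)
  have "symbol_power \<alpha> \<xi> = (\<Prod>j\<leftarrow>coord_list. ?c \<xi> j)" for \<xi> :: "real ^ 'n"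
    unfolding symbol_power_def
    using prod.distinct_set_conv_list[OF coord_list_enum(1), of "?c \<xi>"]
    by (simp add: coord_list_enum(2))
  then show ?thesis
    using foldr_coeffs[of coord_list] by (simp add: mixed_deriv_def)
qed

text \<open>Measurability is what lets the integral against a Dirac measure in
  \<open>point_conv\<close> be evaluated as a point value.\<close>

lemma has_fourier_coeffs_borel_measurable:
  assumes "has_fourier_coeffs \<Xi> b f"
  shows "f \<in> borel_measurable borel"
proof -
  have "f = (\<lambda>x. Re (\<Sum>\<xi>\<in>\<Xi>. b \<xi> * character \<xi> x))"
    using assms by (metis (no_types, lifting) Re_complex_of_real has_fourier_coeffs_def ext)
  moreover have "continuous_on UNIV (\<lambda>x. Re (\<Sum>\<xi>\<in>\<Xi>. b \<xi> * character \<xi> x))"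
    by (intro continuous_intros)
  ultimately show ?thesis
    by (metis borel_measurable_continuous_onI)
qed

text \<open>Characters turn the shift \<open>x - a\<close> into the factor
  \<open>character \<xi> (- a)\<close>; exchanging the two sums collects these factors into the
  multiplier at \<open>\<xi>\<close>.\<close>

lemma point_conv_eq:
  fixes A \<Xi> :: "(real ^ 'n) set"
  assumes "has_fourier_coeffs \<Xi> b f"
  shows "point_conv A u f x =
    (\<Sum>\<xi>\<in>\<Xi>. (\<Sum>a\<in>A. u a * character \<xi> (- a)) * b \<xi> * character \<xi> x)"
proof -
  note [measurable] = has_fourier_coeffs_borel_measurable[OF assms]
  have "(\<integral>y. f (x - y) \<partial>(return borel a)) = f (x - a)" for a
    by (rule integral_return) simp_all
  then have "point_conv A u f x = (\<Sum>a\<in>A. u a * complex_of_real (f (x - a)))"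
    by (simp add: point_conv_def)
  also have "\<dots> = (\<Sum>a\<in>A. \<Sum>\<xi>\<in>\<Xi>. u a * character \<xi> (- a) * b \<xi> * character \<xi> x)"
    using assms character_add[of _ x "- _"]
    by (simp add: has_fourier_coeffs_def sum_distrib_left mult_ac)
  also have "\<dots> = (\<Sum>\<xi>\<in>\<Xi>. \<Sum>a\<in>A. u a * character \<xi> (- a) * b \<xi> * character \<xi> x)"
    by (rule sum.swap)
  finally show ?thesis
    by (simp add: sum_distrib_right)
qed

lemma trig_space_two_characters:
  fixes \<Xi> :: "(real ^ 'n) set"
  assumes "finite \<Xi>" "\<xi> \<in> \<Xi>" "- \<xi> \<in> \<Xi>"
  obtains f b where "f \<in> trig_space \<Xi>" "has_fourier_coeffs \<Xi> b f"
    "\<And>h. (\<Sum>\<eta>\<in>\<Xi>. h \<eta> * b \<eta>) = \<gamma> * h \<xi> + cnj \<gamma> * h (- \<xi>)"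
proof
  \<comment> \<open>Two indicators are added, rather than nested, so that both contributions survive
    when \<open>\<xi> = - \<xi>\<close>, that is, at \<open>\<xi> = 0\<close>.\<close>
  define b where "b = (\<lambda>\<eta>. (if \<eta> = \<xi> then \<gamma> else 0) + (if \<eta> = - \<xi> then cnj \<gamma> else 0))"
  define f where "f = (\<lambda>x. 2 * Re (\<gamma> * character \<xi> x))"
  show sum_b: "(\<Sum>\<eta>\<in>\<Xi>. h \<eta> * b \<eta>) = \<gamma> * h \<xi> + cnj \<gamma> * h (- \<xi>)" for h
  proof -
    have "(\<Sum>\<eta>\<in>\<Xi>. h \<eta> * b \<eta>) =
        (\<Sum>\<eta>\<in>\<Xi>. if \<eta> = \<xi> then \<gamma> * h \<eta> else 0) + (\<Sum>\<eta>\<in>\<Xi>. if \<eta> = - \<xi> then cnj \<gamma> * h \<eta> else 0)"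
      unfolding sum.distrib[symmetric] b_def distrib_left
      by (intro sum.cong refl arg_cong2[where f = "(+)"]) simp_all
    then show ?thesis
      using assms by simp
  qed
  show coeffs: "has_fourier_coeffs \<Xi> b f"
    unfolding has_fourier_coeffs_def
  proof
    fix x
    have "(\<Sum>\<eta>\<in>\<Xi>. b \<eta> * character \<eta> x) = \<gamma> * character \<xi> x + cnj (\<gamma> * character \<xi> x)"
      \<comment> \<open>The weight \<open>h\<close> is arbitrary: characters as weights identify
        \<open>f\<close> here, and the multiplier defects as weights later test feasibility.\<close>
      using sum_b[of "\<lambda>\<eta>. character \<eta> x"] by (simp add: mult.commute character_minus_left)
    then show "complex_of_real (f x) = (\<Sum>\<eta>\<in>\<Xi>. b \<eta> * character \<eta> x)"
      by (simp only: complex_add_cnj f_def)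
  qed
  have "b (- \<eta>) = cnj (b \<eta>)" for \<eta>
    by (auto simp: b_def equation_minus_iff)
  with coeffs show "f \<in> trig_space \<Xi>"
    by (auto simp: trig_space_iff)
qed

theorem mainTheorem1:
  fixes \<Xi> A :: "(real ^ 'n) set"
    and \<alpha> :: "nat ^ 'n"
    and u :: "real ^ 'n \<Rightarrow> complex"
  assumes "finite \<Xi>"
    and "symmetric_set \<Xi>"
    and "\<forall>j. \<alpha> $ j \<ge> 1"
    and "finite A"
  shows "feasible_shift_rule \<Xi> \<alpha> A u \<longleftrightarrow>
    (\<forall>\<xi>\<in>\<Xi>. (\<Sum>a\<in>A. u a * exp (- (2 * complex_of_real pi * \<i> * complex_of_real (a \<bullet> \<xi>))))
      = symbol_power \<alpha> \<xi>)"
proof -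
  define S where "S \<xi> = (\<Sum>a\<in>A. u a * character \<xi> (- a))" for \<xi>
  define c where "c \<xi> = S \<xi> - symbol_power \<alpha> \<xi>" for \<xi>
  \<comment> \<open>Both operators are diagonal on characters, so their difference has coefficients
    \<open>c \<xi> * b \<xi>\<close>.\<close>
  have defect: "point_conv A u f x - complex_of_real (mixed_deriv \<alpha> f x) =
      (\<Sum>\<xi>\<in>\<Xi>. c \<xi> * character \<xi> x * b \<xi>)" if "has_fourier_coeffs \<Xi> b f" for b f x
    using has_fourier_coeffs_mixed_deriv[OF that, of \<alpha>]
    by (simp add: point_conv_eq[OF that] has_fourier_coeffs_def S_def[symmetric] c_def
        algebra_simps flip: sum_subtractf)
  have "feasible_shift_rule \<Xi> \<alpha> A u \<longleftrightarrow> (\<forall>\<xi>\<in>\<Xi>. c \<xi> = 0)"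
  proof
    assume feasible: "feasible_shift_rule \<Xi> \<alpha> A u"
    show "\<forall>\<xi>\<in>\<Xi>. c \<xi> = 0"
    proof
      fix \<xi> assume "\<xi> \<in> \<Xi>"
      moreover from this have "- \<xi> \<in> \<Xi>"
        using \<open>symmetric_set \<Xi>\<close> by (auto simp: symmetric_set_def)
      ultimately have "\<gamma> * c \<xi> + cnj \<gamma> * c (- \<xi>) = 0" for \<gamma>
      proof (rule trig_space_two_characters[OF \<open>finite \<Xi>\<close>, where \<gamma> = \<gamma>])
        fix f b
        assume "f \<in> trig_space \<Xi>" "has_fourier_coeffs \<Xi> b f"
          and sum_b: "\<And>h. (\<Sum>\<eta>\<in>\<Xi>. h \<eta> * b \<eta>) = \<gamma> * h \<xi> + cnj \<gamma> * h (- \<xi>)"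
        then have "(\<Sum>\<eta>\<in>\<Xi>. c \<eta> * b \<eta>) = 0"
          using feasible defect[of b f 0] by (simp add: feasible_shift_rule_def)
        then show ?thesis
          by (simp add: sum_b)
      qed
      \<comment> \<open>\<open>\<gamma> = 1\<close> makes the sum of \<open>c \<xi>\<close> and
        \<open>c (- \<xi>)\<close> vanish, and \<open>\<gamma> = \<i>\<close> their
        difference.\<close>
      from this[of 1] this[of \<i>] show "c \<xi> = 0"
        by (simp add: algebra_simps)
    qed
  next
    assume "\<forall>\<xi>\<in>\<Xi>. c \<xi> = 0"
    then show "feasible_shift_rule \<Xi> \<alpha> A u"
      using defect by (auto simp: feasible_shift_rule_def trig_space_iff)
  qed
  then show ?thesis
    by (simp add: c_def S_def character_minus_right)
qed

end
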